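(* Let $ABC$ be a non-degenerate triangle. Let $l_A, l_B, l_C$ be lines through $A, B, C$ respectively, none of which is a sideline of the triangle, and let $l'_A, l'_B, l'_C$ be the reflections of $l_A, l_B, l_C$ in the bisectors of the angles $A, B, C$ of the triangle, respectively. Suppose that the lines in each of the pairs $(l_B, l'_C)$, $(l_C,l'_A)$, $(l_A,l'_B)$ are not parallel, and put $X = l_B\cap l'_C$, $Y = l_C\cap l'_A$, $Z = l_A\cap l'_B$. Let $H_A$ be the intersection point of $BC$ with the line through $X$ perpendicular to $BC$, let $H_B$ be the intersection point of $CA$ with the line through $Y$ perpendicular to $CA$, and let $H_C$ be the intersection point of $AB$ with the line through $Z$ perpendicular to $AB$. Then the lines $AH_A$, $BH_B$ and $CH_C$ pass through one common point.
   Context: The setting is the Euclidean plane; the concurrency is understood in its projective extension, i.e. the common point may be at infinity (the three lines being parallel). A sideline is one of the lines $AB$, $BC$, $CA$. *)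

theory Defs
  imports "HOL-Analysis.Analysis"
begin

definition is_line :: "(real^2) set \<Rightarrow> bool" where
  "is_line L \<longleftrightarrow> affine L \<and> aff_dim L = 1"

abbreviation line_through :: "real^2 \<Rightarrow> real^2 \<Rightarrow> (real^2) set" where
  "line_through P Q \<equiv> affine hull {P, Q}"

definition perp_through :: "real^2 \<Rightarrow> (real^2) set \<Rightarrow> (real^2) set" where
  "perp_through X L = {P. \<forall>U\<in>L. \<forall>V\<in>L. orthogonal (P - X) (U - V)}"

(* Q is the mirror image of P in the line m iff the midpoint of PQ is on m and PQ is
   perpendicular to m. *)
definition reflection :: "(real^2) set \<Rightarrow> (real^2) set \<Rightarrow> (real^2) set" where
  "reflection m S =
     {Q. \<exists>P\<in>S. midpoint P Q \<in> m \<and> (\<forall>U\<in>m. \<forall>V\<in>m. orthogonal (Q - P) (U - V))}"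

definition vec_angle :: "real^2 \<Rightarrow> real^2 \<Rightarrow> real" where
  "vec_angle u v = arccos (inner u v / (norm u * norm v))"

(* The whole line containing the internal bisector of the angle PVQ: on the ray opposite
   to the bisecting one the two unsigned angles are equal as well, namely to pi minus half
   the angle.  The external bisector is not included: there the two angles add up to pi.
   The vertex V belongs to the set because division by 0 yields 0. *)
definition angle_bisector :: "real^2 \<Rightarrow> real^2 \<Rightarrow> real^2 \<Rightarrow> (real^2) set" where
  "angle_bisector P V Q = {R. vec_angle (P - V) (R - V) = vec_angle (R - V) (Q - V)}"

(* Concurrency of three lines in the projective extension: a common point in the plane,
   or a common point at infinity.  affine_parallel holds of equal lines, too. *)
definition concurrent :: "(real^2) set \<Rightarrow> (real^2) set \<Rightarrow> (real^2) set \<Rightarrow> bool" where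
  "concurrent K L M \<longleftrightarrow>
     K \<inter> L \<inter> M \<noteq> {} \<or> (affine_parallel K L \<and> affine_parallel L M)"

lemma angle_bisector_iff_inner:
  assumes "P \<noteq> V" "Q \<noteq> V"
  shows "R \<in> angle_bisector P V Q \<longleftrightarrow> inner (sgn (P - V) - sgn (Q - V)) (R - V) = 0"
proof (cases "R = V")
  case True
  then show ?thesis by (simp add: angle_bisector_def vec_angle_def)
next
  case False
  have n: "norm (P - V) > 0" "norm (Q - V) > 0" "norm (R - V) > 0"
    using assms False by auto
  have b: "\<bar>inner u v / (norm u * norm v)\<bar> \<le> 1" for u v :: "real^2"
    using Cauchy_Schwarz_ineq2[of u v]
    by (cases "norm u * norm v = 0") (auto simp: abs_mult divide_le_eq_1)
  have "R \<in> angle_bisector P V Q \<longleftrightarrow>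
      inner (P - V) (R - V) / (norm (P - V) * norm (R - V)) =
      inner (R - V) (Q - V) / (norm (R - V) * norm (Q - V))"
    unfolding angle_bisector_def vec_angle_def using b by (simp add: arccos_eq_iff)
  also have "\<dots> \<longleftrightarrow> inner (P - V) (R - V) / norm (P - V) = inner (Q - V) (R - V) / norm (Q - V)"
    using n by (simp add: inner_commute[of "R - V"] field_simps)
  also have "\<dots> \<longleftrightarrow> inner (sgn (P - V) - sgn (Q - V)) (R - V) = 0"
    by (simp add: sgn_div_norm inner_diff_left divide_inverse mult.commute)
  finally show ?thesis .
qed

end

theory Submission
  imports Defs
begin

text \<open>Describe the line \<open>l\<^sub>A\<close> by the cotangent \<open>a\<close> of its directed angle with \<open>AB\<close>; it is
  finite because \<open>l\<^sub>A \<noteq> AB\<close>.  Reflection in the bisector turns this into the angle of \<open>l\<^sub>A'\<close> with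
  \<open>AC\<close>, with the opposite orientation.  With \<open>b\<close>, \<open>c\<close> defined cyclically, the
  height of the triangle \<open>BCX\<close> divides \<open>BC\<close> in the ratio \<open>b : c\<close>, and cyclically, so by Ceva the
  three lines meet in the point with barycentric coordinates \<open>(bc : ca : ab)\<close>, which is at infinity
  if \<open>bc + ca + ab = 0\<close>.\<close>

text \<open>The determinant, that is, the product of the norms and the sine of the directed angle
  from \<open>u\<close> to \<open>v\<close>. Where it is nonzero,
  \<open>inner u v / cross2 u v\<close> is the cotangent of that angle.\<close>

definition cross2 :: "real^2 \<Rightarrow> real^2 \<Rightarrow> real" where
  "cross2 u v = u$1 * v$2 - u$2 * v$1"

lemma inner_real2: "inner u v = u$1 * v$1 + u$2 * v$2" for u v :: "real^2"
  by (simp add: inner_vec_def sum_2)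

lemma cross2_scaleR_right [simp]: "cross2 u (t *\<^sub>R v) = t * cross2 u v"
  by (simp add: cross2_def algebra_simps)

lemma cross2_scaleR_left [simp]: "cross2 (t *\<^sub>R u) v = t * cross2 u v"
  by (simp add: cross2_def algebra_simps)

text \<open>The Binet-Cauchy identity in the plane. It turns products of determinants into inner
  products.\<close>

lemma cross2_mult_cross2:
  "cross2 a b * cross2 c d = inner a c * inner b d - inner a d * inner b c"
  by (simp add: cross2_def inner_real2 algebra_simps)

lemma cross2_eq_0_imp_multiple:
  assumes "cross2 u v = 0" "v \<noteq> 0"
  obtains t where "u = t *\<^sub>R v"
proof
  have "inner v v \<noteq> 0" using assms(2) by simp
  \<comment> \<open>The difference of the two sides is \<open>cross2 u v\<close> times
    \<open>v\<close> turned by a right angle.\<close>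
  moreover have "inner v v *\<^sub>R u = inner u v *\<^sub>R v"
    using assms(1) by (simp add: vec_eq_iff forall_2 inner_real2 cross2_def) algebra
  ultimately show "u = (inner u v / inner v v) *\<^sub>R v"
    by (metis divide_inverse_commute scaleR_left_imp_eq scaleR_scaleR right_inverse scaleR_one
        mult.assoc mult_1)
qed

lemma mem_line_through:
  "P \<in> line_through A B \<longleftrightarrow> (\<exists>t. P = A + t *\<^sub>R (B - A))"
proof -
  have "P \<in> line_through A B \<longleftrightarrow> (\<exists>t. P = (1 - t) *\<^sub>R A + t *\<^sub>R B)"
    by (auto simp: affine_hull_2 intro: exI[of _ "1 - _"] ) (metis add_diff_cancel_right')+
  then show ?thesis by (simp add: algebra_simps)
qed

lemma is_line_eq_line_through:
  assumes "is_line L" "A \<in> L" "B \<in> L" "A \<noteq> B"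
  shows "L = line_through A B"
proof -
  have "affine L" "aff_dim L = 1" using assms(1) by (auto simp: is_line_def)
  moreover have "line_through A B \<subseteq> L"
    using assms \<open>affine L\<close> by (simp add: hull_minimal)
  moreover have "aff_dim (line_through A B) = 1"
    using assms(4) by (simp add: aff_dim_2)
  ultimately show ?thesis
    using affine_dim_equal[of "line_through A B" L] by auto
qed

text \<open>Both sides are linear in \<open>Q - V\<close>, which runs through the multiples of one
  vector, so one point of \<open>L\<close> other than \<open>V\<close> determines \<open>k\<close>.
  Without a division, the equation also covers \<open>Q = V\<close>.\<close>

lemma line_cotangent:
  assumes L: "is_line L" "V \<in> L" and P: "P \<noteq> V" "L \<noteq> line_through V P"
  obtains k where "\<And>Q. Q \<in> L \<Longrightarrow> inner (P - V) (Q - V) = k * cross2 (P - V) (Q - V)"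
proof -
  have "L \<noteq> {V}" using L(1) by (auto simp: is_line_def)
  then obtain W where W: "W \<in> L" "W \<noteq> V" using L(2) by auto
  then have LW: "L = line_through V W" using is_line_eq_line_through L by metis
  have nz: "cross2 (P - V) (W - V) \<noteq> 0"
  proof
    assume "cross2 (P - V) (W - V) = 0"
    then obtain t where "P - V = t *\<^sub>R (W - V)"
      using cross2_eq_0_imp_multiple W(2) by (metis right_minus_eq)
    then have "P \<in> L" unfolding LW mem_line_through by (metis add.commute diff_add_cancel)
    then show False using is_line_eq_line_through L P by metis
  qed
  show thesis
  proof (rule that)
    fix Q assume "Q \<in> L"
    then obtain t where "Q = V + t *\<^sub>R (W - V)" unfolding LW mem_line_through by blast
    then show "inner (P - V) (Q - V) =
        (inner (P - V) (W - V) / cross2 (P - V) (W - V)) * cross2 (P - V) (Q - V)"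
      using nz by simp
  qed
qed

text \<open>The reflection exchanges the directions of the two sides of the angle; it preserves
  inner products and reverses the sign of determinants, hence \<open>- k\<close>.\<close>

lemma reflection_cotangent:
  assumes nz: "cross2 (P - V) (Q - V) \<noteq> 0"
    and k: "\<And>R. R \<in> L \<Longrightarrow> inner (P - V) (R - V) = k * cross2 (P - V) (R - V)"
    and S: "S \<in> reflection (angle_bisector P V Q) L"
  shows "inner (Q - V) (S - V) = - k * cross2 (Q - V) (S - V)"
proof -
  have ne: "P \<noteq> V" "Q \<noteq> V" using nz by (auto simp: cross2_def)
  define e f where "e = sgn (P - V)" and "f = sgn (Q - V)"
  have PV: "P - V = norm (P - V) *\<^sub>R e" and QV: "Q - V = norm (Q - V) *\<^sub>R f"
    using ne by (simp_all add: e_def f_def sgn_div_norm)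
  have unit: "inner e e = 1" "inner f f = 1"
    using ne by (simp_all add: e_def f_def norm_sgn flip: power2_norm_eq_inner)
  have ef: "cross2 e f \<noteq> 0" using nz by (subst (asm) PV, subst (asm) QV) auto
  obtain R where R: "R \<in> L" "midpoint R S \<in> angle_bisector P V Q"
    and orth: "\<And>U W. U \<in> angle_bisector P V Q \<Longrightarrow> W \<in> angle_bisector P V Q \<Longrightarrow>
      orthogonal (S - R) (U - W)"
    using S by (auto simp: reflection_def)
  define p y where "p = R - V" and "y = S - V"
  \<comment> \<open>The bisector is the line through \<open>V\<close> orthogonal to
    \<open>e - f\<close>. As \<open>e\<close> and \<open>f\<close> are unit vectors,
    \<open>e + f\<close> is a direction vector of it.\<close>
  have "V + (e + f) \<in> angle_bisector P V Q" "V \<in> angle_bisector P V Q"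
    using unit ne
    by (auto simp: angle_bisector_iff_inner inner_commute algebra_simps simp flip: e_def f_def)
  from orth[OF this] have 1: "inner (y - p) (e + f) = 0"
    by (simp add: orthogonal_def p_def y_def)
  have "midpoint R S - V = (1/2) *\<^sub>R (p + y)"
    by (simp add: midpoint_def p_def y_def vec_eq_iff field_simps)
  then have 2: "inner (p + y) (e - f) = 0"
    using R(2) ne by (simp add: angle_bisector_iff_inner inner_commute flip: e_def f_def)
  \<comment> \<open>The reflection swaps \<open>e\<close> and \<open>f\<close>.\<close>
  have swap: "inner e y = inner f p" "inner f y = inner e p"
    using 1 2 by (simp_all add: inner_commute algebra_simps)
  \<comment> \<open>After multiplication by \<open>cross2 e f\<close>, both determinants become
    expressions in inner products, which cancel by \<open>swap\<close>.\<close>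
  have "cross2 e f * (cross2 f y + cross2 e p) = 0"
    using swap unit unfolding distrib_left cross2_mult_cross2
    by (simp add: inner_commute[of f e] mult.commute)
  then have cross: "cross2 f y = - cross2 e p" using ef by simp
  have "norm (P - V) * inner e p = norm (P - V) * (k * cross2 e p)"
    using k[OF R(1)] by (subst (asm) (1 2) PV) (simp add: p_def)
  then have "inner e p = k * cross2 e p" using ne by simp
  then have "inner f y = - k * cross2 f y" using swap cross by simp
  then show ?thesis by (subst (1 2) QV) (simp add: y_def)
qed

text \<open>Here \<open>h\<close> is the length of \<open>BC\<close> times the signed height of
  \<open>X\<close> over it. Up to that length, the signed distances from \<open>B\<close> to the
  foot and from the foot to \<open>C\<close> are \<open>b * h\<close> and \<open>c * h\<close>, so
  the ratio is \<open>b : c\<close>.\<close>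

lemma foot_of_height:
  assumes "B \<noteq> C"
    and b: "inner (C - B) (X - B) = b * cross2 (C - B) (X - B)"
    and c: "inner (B - C) (X - C) = - c * cross2 (B - C) (X - C)"
    and H: "H \<in> line_through B C \<inter> perp_through X (line_through B C)"
  shows "b + c \<noteq> 0" "(b + c) *\<^sub>R H = c *\<^sub>R B + b *\<^sub>R C"
proof -
  define D h where "D = C - B" and "h = cross2 D (X - B)"
  have D: "inner D D \<noteq> 0" using assms(1) by (simp add: D_def)
  have bh: "inner D (X - B) = b * h" using b by (simp add: D_def h_def)
  have "cross2 (B - C) (X - C) = - h" "inner (B - C) (X - C) = inner D D - inner D (X - B)"
    by (simp_all add: cross2_def inner_real2 D_def h_def algebra_simps)
  \<comment> \<open>The two segments add up to the whole side. Since its length is nonzero, neither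
    \<open>b + c\<close> nor \<open>h\<close> can vanish.\<close>
  then have s: "(b + c) * h = inner D D" using bh c by (simp add: algebra_simps)
  then show "b + c \<noteq> 0" using D by auto
  from H obtain t where t: "H = B + t *\<^sub>R D" by (auto simp: mem_line_through D_def)
  have "orthogonal (H - X) (C - B)"
    using H by (auto simp: perp_through_def hull_inc)
  then have "t * inner D D = b * h"
    using bh by (simp add: t orthogonal_def inner_commute flip: D_def) (simp add: algebra_simps inner_commute)
  then have "(t * (b + c) - b) * h = 0" using s by (simp add: algebra_simps flip: s)
  moreover have "h \<noteq> 0" using s D by auto
  ultimately have "(b + c) * t = b" by (simp add: mult.commute)
  then have "(b + c) *\<^sub>R H = (b + c) *\<^sub>R B + b *\<^sub>R D"
    by (simp add: t scaleR_add_right)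
  then show "(b + c) *\<^sub>R H = c *\<^sub>R B + b *\<^sub>R C"
    by (simp add: D_def algebra_simps)
qed

lemma affine_parallel_line_through:
  assumes "r *\<^sub>R (Q - P) = s *\<^sub>R (Q' - P')" "r \<noteq> 0" "s \<noteq> 0"
  shows "affine_parallel (line_through P Q) (line_through P' Q')"
proof -
  have Q: "Q - P = (s / r) *\<^sub>R (Q' - P')"
    using assms by (metis divide_inverse_commute right_inverse scaleR_one scaleR_scaleR mult.commute)
  have Q': "Q' - P' = (r / s) *\<^sub>R (Q - P)" using assms Q by simp
  have "line_through P' Q' = (\<lambda>x. (P' - P) + x) ` line_through P Q"
  proof (intro equalityI subsetI)
    fix R assume "R \<in> line_through P' Q'"
    then obtain t where "R = P' + t *\<^sub>R (Q' - P')" unfolding mem_line_through by blast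
    then have "R = (P' - P) + (P + (t * (r / s)) *\<^sub>R (Q - P))" unfolding Q' by simp
    then show "R \<in> (\<lambda>x. (P' - P) + x) ` line_through P Q"
      unfolding image_iff Bex_def mem_line_through by blast
  next
    fix R assume "R \<in> (\<lambda>x. (P' - P) + x) ` line_through P Q"
    then obtain t where "R = (P' - P) + (P + t *\<^sub>R (Q - P))"
      unfolding image_iff Bex_def mem_line_through by blast
    then have "R = P' + (t * (s / r)) *\<^sub>R (Q' - P')" unfolding Q by simp
    then show "R \<in> line_through P' Q'" unfolding mem_line_through by blast
  qed
  then show ?thesis unfolding affine_parallel_def by blast
qed

text \<open>The vector \<open>w\<close> carries the unnormalised barycentric coordinates, with sum
  \<open>s\<close>. It is \<open>s\<close> times a vertex plus a multiple of the direction of the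
  cevian there, for all three vertices. So \<open>w\<close> yields a common point if
  \<open>s\<close> is nonzero, and a common direction otherwise.\<close>

lemma ceva_concurrent:
  fixes A B C K L M :: "real^2"
  assumes ne: "b + c \<noteq> 0" "c + a \<noteq> 0" "a + b \<noteq> 0"
    and K: "(b + c) *\<^sub>R K = c *\<^sub>R B + b *\<^sub>R C"
    and L: "(c + a) *\<^sub>R L = a *\<^sub>R C + c *\<^sub>R A"
    and M: "(a + b) *\<^sub>R M = b *\<^sub>R A + a *\<^sub>R B"
  shows "concurrent (line_through A K) (line_through B L) (line_through C M)"
proof -
  define w s where "w = (b * c) *\<^sub>R A + (c * a) *\<^sub>R B + (a * b) *\<^sub>R C"
    and "s = b * c + c * a + a * b"
  \<comment> \<open>Splitting the factor \<open>a * (b + c)\<close> exposes the left-hand side of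
    \<open>K\<close>, and likewise for \<open>L\<close> and \<open>M\<close>.\<close>
  have scale: "(x * y) *\<^sub>R v = x *\<^sub>R (y *\<^sub>R v)" for x y and v :: "real^2" by simp
  have wK: "w = s *\<^sub>R A + (a * (b + c)) *\<^sub>R (K - A)"
    unfolding scaleR_diff_right scale K by (simp add: w_def s_def algebra_simps)
  have wL: "w = s *\<^sub>R B + (b * (c + a)) *\<^sub>R (L - B)"
    unfolding scaleR_diff_right scale L by (simp add: w_def s_def algebra_simps)
  have wM: "w = s *\<^sub>R C + (c * (a + b)) *\<^sub>R (M - C)"
    unfolding scaleR_diff_right scale M by (simp add: w_def s_def algebra_simps)
  show ?thesis
  proof (cases "s = 0")
    case False
    have on: "(1 / s) *\<^sub>R w \<in> line_through P Q" if "w = s *\<^sub>R P + r *\<^sub>R (Q - P)" for P Q r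
    proof -
      have "(1 / s) *\<^sub>R w = P + (r / s) *\<^sub>R (Q - P)"
        using False by (simp add: that scaleR_add_right)
      then show ?thesis unfolding mem_line_through by blast
    qed
    show ?thesis unfolding concurrent_def using on[OF wK] on[OF wL] on[OF wM] by blast
  next
    case True
    \<comment> \<open>If \<open>a = 0\<close>, then \<open>s = 0\<close> leaves
      \<open>b * c = 0\<close>, so \<open>a + b\<close> or \<open>c + a\<close> would vanish; the
      other cases are cyclic.\<close>
    then have "a \<noteq> 0" "b \<noteq> 0" "c \<noteq> 0" using ne by (auto simp: s_def)
    then have "affine_parallel (line_through A K) (line_through B L)"
      "affine_parallel (line_through B L) (line_through C M)"
      using affine_parallel_line_through[of "a * (b + c)" K A "b * (c + a)" L B]
        affine_parallel_line_through[of "b * (c + a)" L B "c * (a + b)" M C]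
        wK wL wM True ne by simp_all
    then show ?thesis unfolding concurrent_def by blast
  qed
qed

theorem theorem2:
  fixes A B C X Y Z H\<^sub>A H\<^sub>B H\<^sub>C :: "real^2"
    and l\<^sub>A l\<^sub>B l\<^sub>C l\<^sub>A' l\<^sub>B' l\<^sub>C' :: "(real^2) set"
  assumes "\<not> collinear {A, B, C}"
    and "is_line l\<^sub>A" and "is_line l\<^sub>B" and "is_line l\<^sub>C"
    and "A \<in> l\<^sub>A" and "B \<in> l\<^sub>B" and "C \<in> l\<^sub>C"
    and "l\<^sub>A \<notin> {line_through A B, line_through B C, line_through C A}"
    and "l\<^sub>B \<notin> {line_through A B, line_through B C, line_through C A}"
    and "l\<^sub>C \<notin> {line_through A B, line_through B C, line_through C A}"
    and "l\<^sub>A' = reflection (angle_bisector B A C) l\<^sub>A"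
    and "l\<^sub>B' = reflection (angle_bisector C B A) l\<^sub>B"
    and "l\<^sub>C' = reflection (angle_bisector A C B) l\<^sub>C"
    and "\<not> affine_parallel l\<^sub>B l\<^sub>C'"
    and "\<not> affine_parallel l\<^sub>C l\<^sub>A'"
    and "\<not> affine_parallel l\<^sub>A l\<^sub>B'"
    and "X \<in> l\<^sub>B \<inter> l\<^sub>C'" and "Y \<in> l\<^sub>C \<inter> l\<^sub>A'" and "Z \<in> l\<^sub>A \<inter> l\<^sub>B'"
    and "H\<^sub>A \<in> line_through B C \<inter> perp_through X (line_through B C)"
    and "H\<^sub>B \<in> line_through C A \<inter> perp_through Y (line_through C A)"
    and "H\<^sub>C \<in> line_through A B \<inter> perp_through Z (line_through A B)"
  shows "concurrent (line_through A H\<^sub>A) (line_through B H\<^sub>B) (line_through C H\<^sub>C)"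
proof -
  have area: "cross2 (B - A) (C - A) \<noteq> 0"
  proof
    assume 0: "cross2 (B - A) (C - A) = 0"
    have "C \<noteq> A" using assms(1) by (auto simp: insert_commute)
    then obtain t where "B - A = t *\<^sub>R (C - A)"
      using cross2_eq_0_imp_multiple 0 by (metis right_minus_eq)
    then have "B \<in> line_through A C" unfolding mem_line_through by (metis add.commute diff_add_cancel)
    then have "collinear {A, C, B}" using \<open>C \<noteq> A\<close> by (simp add: collinear_3_affine_hull)
    then show False using assms(1) by (simp add: insert_commute)
  qed
  then have nz: "cross2 (C - B) (A - B) \<noteq> 0" "cross2 (A - C) (B - C) \<noteq> 0"
    by (simp_all add: cross2_def algebra_simps)
  have ne: "B \<noteq> A" "C \<noteq> B" "A \<noteq> C" using assms(1) by (auto simp: insert_commute)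
  \<comment> \<open>The angles are measured from \<open>AB\<close>, \<open>BC\<close>,
    \<open>CA\<close> in cyclic order, and those of the reflected lines from \<open>AC\<close>,
    \<open>BA\<close>, \<open>CB\<close>. Thus each side meets one given and one reflected line, as
    \<open>foot_of_height\<close> requires.\<close>
  obtain a where a: "\<And>Q. Q \<in> l\<^sub>A \<Longrightarrow> inner (B - A) (Q - A) = a * cross2 (B - A) (Q - A)"
    using line_cotangent[of l\<^sub>A A B] assms(2,5,8) ne by blast
  obtain b where b: "\<And>Q. Q \<in> l\<^sub>B \<Longrightarrow> inner (C - B) (Q - B) = b * cross2 (C - B) (Q - B)"
    using line_cotangent[of l\<^sub>B B C] assms(3,6,9) ne by blast
  obtain c where c: "\<And>Q. Q \<in> l\<^sub>C \<Longrightarrow> inner (A - C) (Q - C) = c * cross2 (A - C) (Q - C)"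
    using line_cotangent[of l\<^sub>C C A] assms(4,7,10) ne by blast
  have a': "inner (C - A) (Y - A) = - a * cross2 (C - A) (Y - A)"
    using reflection_cotangent[OF area a] assms(11,18) by blast
  have b': "inner (A - B) (Z - B) = - b * cross2 (A - B) (Z - B)"
    using reflection_cotangent[OF nz(1) b] assms(12,19) by blast
  have c': "inner (B - C) (X - C) = - c * cross2 (B - C) (X - C)"
    using reflection_cotangent[OF nz(2) c] assms(13,17) by blast
  have X: "X \<in> l\<^sub>B" and Y: "Y \<in> l\<^sub>C" and Z: "Z \<in> l\<^sub>A" using assms(17-19) by auto
  note HA = foot_of_height[OF ne(2)[symmetric] b[OF X] c' assms(20)]
    and HB = foot_of_height[OF ne(3)[symmetric] c[OF Y] a' assms(21)]
    and HC = foot_of_height[OF ne(1)[symmetric] a[OF Z] b' assms(22)]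
  show ?thesis by (rule ceva_concurrent[OF HA(1) HB(1) HC(1) HA(2) HB(2) HC(2)])
qed

end
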